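(* Let $s\in\mathbb{F}_q$ be such that $c := 1-s^2 \in \mathcal{C}$, and let $x$ be a zero of $g_s(y)$ (in an algebraic closure of $\mathbb{F}_q$) of degree $d>2$ over $\mathbb{F}_q$. Then $d=e$, where $e$ is the period of the sequence $S(c)$.
   Context: $\mathbb{F}_q$ is a finite field with $q$ elements, $q$ a power of an odd prime; $n=(q+1)/2$; for $s\in\mathbb{F}_q$, $g_s(y) := y^n+(1-y)^n-s \in \mathbb{F}_q[y]$. $\rho$ is the quadratic character on $\mathbb{F}_q$ (with $\rho(0)=0$), and $\mathcal{C} := \{a \in \mathbb{F}_q : \rho(a)=\rho(1-a)=1\}$. For $c\in\mathcal{C}$, $S(c)=\langle c_k\rangle_{k\in\mathbb{Z}}$ is the bilateral sequence in $\mathbb{F}_q$ defined by $c_0=0$, $c_1=c$, and $c_{k+1}=(2-4c)c_k-c_{k-1}+2c$ for all $k\in\mathbb{Z}$. This sequence is purely periodic; its period $e$ is the least positive integer with $c_{k+e}=c_k$ for all $k\in\mathbb{Z}$. The degree of an algebraic element over $\mathbb{F}_q$ is the degree of its minimal polynomial. *)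

theory Defs
  imports "HOL-Algebra.Algebraic_Closure_Type" "HOL-Library.Cardinality"
begin

definition quad_char :: "'a :: field \<Rightarrow> int" where
  "quad_char a = (if a = 0 then 0 else if (\<exists>b. b ^ 2 = a) then 1 else -1)"

definition C_set :: "'a :: field set" where
  "C_set = {a. quad_char a = 1 \<and> quad_char (1 - a) = 1}"

definition g_poly :: "'a :: {field, finite} \<Rightarrow> 'a poly" where
  "g_poly s = (let n = (CARD('a) + 1) div 2 in [:0, 1:] ^ n + (1 - [:0, 1:]) ^ n - [:s:])"

text \<open>
  The bilateral recursion is solved for the term of larger index when \<open>k > 1\<close> and for the
  term of smaller index when \<open>k < 0\<close>; \<open>S_seq_rec\<close> and \<open>S_seq_unique\<close> show that \<open>S_seq c\<close>
  is the only sequence with the two prescribed values that satisfies the recursion at every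
  integer.
\<close>

function S_seq :: "'a :: comm_ring_1 \<Rightarrow> int \<Rightarrow> 'a" where
  "S_seq c k =
     (if k = 0 then 0
      else if k = 1 then c
      else if k > 1 then (2 - 4 * c) * S_seq c (k - 1) - S_seq c (k - 2) + 2 * c
      else (2 - 4 * c) * S_seq c (k + 1) - S_seq c (k + 2) + 2 * c)"
  by auto
termination
  by (relation "measure (\<lambda>(c, k). nat \<bar>2 * k - 1\<bar>)") auto

declare S_seq.simps [simp del]

lemma S_seq_0 [simp]: "S_seq c 0 = 0"
  and S_seq_1 [simp]: "S_seq c 1 = c"
  by (subst S_seq.simps; simp)+

lemma S_seq_rec: "S_seq c (k + 1) = (2 - 4 * c) * S_seq c k - S_seq c (k - 1) + 2 * c"
proof (cases "k \<ge> 1")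
  case True
  then show ?thesis by (subst S_seq.simps) simp
next
  case False
  then have "S_seq c (k - 1) = (2 - 4 * c) * S_seq c k - S_seq c (k + 1) + 2 * c"
    by (subst S_seq.simps) (simp add: add.commute)
  then show ?thesis by simp
qed

lemma S_seq_unique:
  assumes "f 0 = 0" "f 1 = c"
    and rec: "\<And>k::int. f (k + 1) = (2 - 4 * c) * f k - f (k - 1) + 2 * c"
  shows "f = S_seq c"
proof -
  have up: "f (int m) = S_seq c (int m) \<and> f (int m + 1) = S_seq c (int m + 1)" for m
  proof (induction m)
    case 0
    then show ?case using assms(1,2) by simp
  next
    case (Suc m)
    then show ?case
      using rec[of "int m + 1"] S_seq_rec[of c "int m + 1"] by (simp add: ac_simps)
  qed
  have down: "f (- int m) = S_seq c (- int m) \<and> f (1 - int m) = S_seq c (1 - int m)" for m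
  proof (induction m)
    case 0
    then show ?case using assms(1,2) by simp
  next
    case (Suc m)
    have "f (- int m - 1) = (2 - 4 * c) * f (- int m) - f (1 - int m) + 2 * c"
      using rec[of "- int m"] by simp
    moreover have "S_seq c (- int m - 1)
        = (2 - 4 * c) * S_seq c (- int m) - S_seq c (1 - int m) + 2 * c"
      using S_seq_rec[of c "- int m"] by simp
    moreover have "- int (Suc m) = - int m - 1" "1 - int (Suc m) = - int m" by simp_all
    ultimately show ?case using Suc by metis
  qed
  show ?thesis
  proof
    fix k show "f k = S_seq c k"
      using up[of "nat k"] down[of "nat (- k)"] by (cases "k \<ge> 0") auto
  qed
qed

definition is_period :: "(int \<Rightarrow> 'a) \<Rightarrow> nat \<Rightarrow> bool" where
  "is_period f e \<longleftrightarrow> e > 0 \<and> (\<forall>k. f (k + int e) = f k)"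

definition seq_period :: "(int \<Rightarrow> 'a) \<Rightarrow> nat" where
  "seq_period f = (LEAST e. is_period f e)"

lemma S_seq_has_period: "\<exists>e. is_period (S_seq (c :: 'a :: {comm_ring_1, finite})) e"
proof -
  define h where "h = (\<lambda>m::nat. (S_seq c (int m), S_seq c (int m + 1)))"
  have "\<not> inj h"
    using finite_imageD[of h UNIV] by auto
  then obtain i j where ij: "i < j" "h i = h j"
    unfolding inj_def by (metis linorder_neqE_nat)
  define e where "e = j - i"
  have e: "e > 0" "int j = int i + int e" using ij by (auto simp: e_def)
  have up: "S_seq c (int i + int m + int e) = S_seq c (int i + int m) \<and>
            S_seq c (int i + int m + 1 + int e) = S_seq c (int i + int m + 1)" for m
  proof (induction m)
    case 0
    then show ?case using ij e by (simp add: h_def algebra_simps)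
  next
    case (Suc m)
    then show ?case
      using S_seq_rec[of c "int i + int m + 1 + int e"] S_seq_rec[of c "int i + int m + 1"]
      by (simp add: ac_simps)
  qed
  have down: "S_seq c (int i - int m + int e) = S_seq c (int i - int m) \<and>
            S_seq c (int i - int m + 1 + int e) = S_seq c (int i - int m + 1)" for m
  proof (induction m)
    case 0
    then show ?case using up[of 0] by simp
  next
    case (Suc m)
    let ?k = "int i - int m"
    have "S_seq c (?k + int e - 1)
        = (2 - 4 * c) * S_seq c (?k + int e) - S_seq c (?k + 1 + int e) + 2 * c"
      using S_seq_rec[of c "?k + int e"] by (simp add: ac_simps)
    moreover have "S_seq c (?k - 1) = (2 - 4 * c) * S_seq c ?k - S_seq c (?k + 1) + 2 * c"
      using S_seq_rec[of c ?k] by simp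
    moreover have "int i - int (Suc m) + int e = ?k + int e - 1" "int i - int (Suc m) = ?k - 1"
      "int i - int (Suc m) + 1 + int e = ?k + int e" "int i - int (Suc m) + 1 = ?k"
      by simp_all
    ultimately show ?case using Suc by metis
  qed
  have "S_seq c (k + int e) = S_seq c k" for k
    using up[of "nat (k - int i)"] down[of "nat (int i - k)"]
    by (cases "k \<ge> int i") auto
  with e(1) show ?thesis unfolding is_period_def by blast
qed

definition is_min_poly :: "'a :: field alg_closure \<Rightarrow> 'a poly \<Rightarrow> bool" where
  "is_min_poly x p \<longleftrightarrow>
     lead_coeff p = 1 \<and> poly (map_poly to_ac p) x = 0 \<and>
     (\<forall>r. r \<noteq> 0 \<and> poly (map_poly to_ac r) x = 0 \<longrightarrow> degree p \<le> degree r)"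

definition min_poly :: "'a :: field alg_closure \<Rightarrow> 'a poly" where
  "min_poly x = (THE p. is_min_poly x p)"

definition alg_degree :: "'a :: field alg_closure \<Rightarrow> nat" where
  "alg_degree x = degree (min_poly x)"

lemma is_min_poly_min_poly:
  assumes "r \<noteq> 0" "poly (map_poly to_ac r) x = 0"
  shows "is_min_poly x (min_poly x)"
proof -
  let ?P = "\<lambda>r. r \<noteq> 0 \<and> poly (map_poly to_ac r) x = 0"
  have diff: "map_poly to_ac (p - q) = map_poly to_ac p - map_poly to_ac q" for p q :: "'a poly"
    by (intro poly_eqI) (simp add: coeff_map_poly)
  have smult: "map_poly to_ac (smult c p) = smult (to_ac c) (map_poly to_ac p)" for c and p :: "'a poly"
    by (intro poly_eqI) (simp add: coeff_map_poly)
  obtain p where p: "?P p" and least: "\<And>r. ?P r \<Longrightarrow> degree p \<le> degree r"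
    using ex_has_least_nat[of ?P r degree] assms by blast
  define p0 where "p0 = smult (inverse (lead_coeff p)) p"
  have p0: "is_min_poly x p0"
    using p least by (auto simp: is_min_poly_def p0_def smult)
  have "q = p0" if q: "is_min_poly x q" for q
  proof (rule ccontr)
    assume neq: "q \<noteq> p0"
    have nz: "q \<noteq> 0" "p0 \<noteq> 0"
      using q p0 by (auto simp: is_min_poly_def)
    then have deg: "degree q = degree p0"
      using q p0 unfolding is_min_poly_def by (meson order_antisym)
    have root: "poly (map_poly to_ac (q - p0)) x = 0"
      using q p0 by (simp add: is_min_poly_def diff)
    have cf: "coeff (q - p0) (degree p0) = 0"
      using q p0 deg by (simp add: is_min_poly_def)
    have le: "degree p0 \<le> degree (q - p0)"
      using p0 root neq by (auto simp: is_min_poly_def)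
    have "degree (q - p0) = degree p0"
      using degree_diff_le_max[of q p0] deg le by simp
    then have "lead_coeff (q - p0) = 0" using cf by simp
    with neq show False by (simp only: leading_coeff_0_iff) simp
  qed
  with p0 show ?thesis
    unfolding min_poly_def by (rule theI)
qed

end

theory Submission
  imports Defs "HOL-Number_Theory.Residues"
begin

text \<open>
  Write \<open>q\<close> for the size of the ground field and \<open>x\<^sub>k\<close> for \<open>x ^ (q ^ k)\<close>. The idea is that the
  conjugates \<open>x\<^sub>k\<close> and the terms \<open>c\<^sub>k\<close> of \<open>S_seq c\<close> solve the same second-order recurrence, and that
  the periods of a nonconstant solution depend only on the recurrence.

  With \<open>u = x ^ n\<close> and \<open>v = (1 - x) ^ n\<close>, where \<open>2 * n = q + 1\<close>, one has \<open>u\<^sup>2 = x * x\<^sub>1\<close> and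
  \<open>v\<^sup>2 = (1 - x) * (1 - x\<^sub>1)\<close>. Eliminating \<open>u\<close> and \<open>v\<close> from \<open>u + v = s\<close> leaves the relation
  \<open>(x + x\<^sub>1 - c)\<^sup>2 = 4 * (1 - c) * x * x\<^sub>1\<close> (\<open>root_g_poly_relation\<close>). It is symmetric in \<open>x\<close> and
  \<open>x\<^sub>1\<close>, so, together with its image under Frobenius, it makes both \<open>x\<close> and \<open>x\<^sub>2\<close> roots of one
  quadratic polynomial over the field generated by \<open>x\<^sub>1\<close>. A degree above 2 means \<open>x\<^sub>2 \<noteq> x\<close>, hence
  the sum of the two roots is read off from that polynomial:
  \<open>x\<^sub>2 + x = (2 - 4 * c) * x\<^sub>1 + 2 * c\<close> (\<open>frob_recurrence\<close>). This is the recurrence of \<open>S_seq c\<close>.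

  The substitution \<open>y \<mapsto> 2 - 4 * y\<close> turns it into
  \<open>u\<^bsub>k+2\<^esub> = (w + v) * u\<^bsub>k+1\<^esub> - u\<^sub>k\<close> with \<open>w * v = 1\<close> and \<open>w + v = 2 - 4 * c\<close>; here \<open>w \<noteq> v\<close>
  because \<open>c\<close> is neither 0 nor 1. Every nonzero solution has period \<open>m\<close> exactly
  if \<open>w ^ m = 1\<close> (\<open>periodic_iff_power_eq_1\<close>). So both \<open>S_seq c\<close> and \<open>x\<^sub>k\<close> have the order of \<open>w\<close> as
  least period, and the least period of the conjugates is the degree of \<open>x\<close>
  (\<open>alg_degree_eq_Least\<close>).
\<close>

section \<open>The Frobenius map on the algebraic closure of a finite field\<close>

lemma power_card_eq_same:
  fixes a :: "'a :: {field, finite}"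
  shows "a ^ CARD('a) = a"
proof (cases "a = 0")
  case True
  then show ?thesis by (simp add: power_0_left)
next
  case False
  let ?U = "UNIV - {0 :: 'a}"
  have "bij_betw ((*) a) ?U ?U"
    by (rule bij_betwI[of _ _ _ "\<lambda>y. y / a"]) (use False in auto)
  then have "(\<Prod>y\<in>?U. a * y) = (\<Prod>y\<in>?U. y)"
    by (rule prod.reindex_bij_betw)
  then have "a ^ card ?U * (\<Prod>y\<in>?U. y) = (\<Prod>y\<in>?U. y)"
    by (simp only: prod.distrib prod_constant)
  then have "a ^ card ?U = 1" by simp
  moreover have "CARD('a) = Suc (card ?U)"
    using card.remove[of "UNIV :: 'a set" 0] by simp
  ultimately show ?thesis by (simp only: power_Suc mult_1_right)
qed

lemma card_field_gt_1: "CARD('a :: {field, finite}) > 1"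
  using card_mono[of UNIV "{0, 1 :: 'a}"] by simp

text \<open>
  Both sides, as polynomials in \<open>z\<close>, are monic of degree \<open>q\<close> and vanish on the ground field.
\<close>

lemma power_card_diff_self_eq_prod:
  fixes z :: "'a :: {field, finite} alg_closure"
  shows "z ^ CARD('a) - z = (\<Prod>a\<in>UNIV. z - to_ac (a :: 'a))"
proof -
  define p :: "'a alg_closure poly" where "p = monom 1 (CARD('a)) + [:0, -1:]"
  define r :: "'a alg_closure poly" where "r = (\<Prod>a\<in>UNIV. [:- to_ac (a :: 'a), 1:])"
  have gt1: "CARD('a) > 1" by (rule card_field_gt_1)
  have deg_p: "degree p = CARD('a)"
    unfolding p_def by (subst degree_add_eq_left) (use gt1 in \<open>auto simp: degree_monom_eq\<close>)
  have deg_r: "degree r = CARD('a)"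
    unfolding r_def by (subst degree_prod_eq_sum_degree) auto
  have "lead_coeff r = 1"
    unfolding r_def by (simp add: lead_coeff_prod)
  then have "coeff p (CARD('a)) = coeff r (CARD('a))"
    using deg_r gt1 by (auto simp: p_def coeff_pCons split: nat.splits)
  moreover have "poly p x = poly r x" if "x \<in> range to_ac" for x
    using that by (auto simp: p_def r_def poly_prod poly_monom power_card_eq_same prod_zero_iff
        simp flip: to_ac_power)
  ultimately have "p = r"
    using deg_p deg_r
    by (intro poly_eqI_degree_lead_coeff[where n = "CARD('a)" and A = "range to_ac"])
       (auto simp: card_image inj_to_ac)
  then have "poly p z = poly r z" by simp
  then show ?thesis by (simp add: p_def r_def poly_prod poly_monom)
qed

lemma power_card_eq_self_iff:
  fixes z :: "'a :: {field, finite} alg_closure"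
  shows "z ^ CARD('a) = z \<longleftrightarrow> z \<in> range to_ac"
proof -
  have "z ^ CARD('a) = z \<longleftrightarrow> (\<Prod>a\<in>UNIV. z - to_ac (a :: 'a)) = 0"
    by (subst power_card_diff_self_eq_prod [symmetric]) simp
  also have "\<dots> \<longleftrightarrow> (\<exists>a::'a. z = to_ac a)"
    by simp
  finally show ?thesis by blast
qed

text \<open>
  The product formula shows that \<open>z ^ q - z\<close> is invariant under translation by elements of the
  ground field, which is the claim when \<open>y\<close> lies in that field. For fixed \<open>z\<close> the difference
  of the two sides is a polynomial in \<open>y\<close> of degree below \<open>q\<close>, so having these \<open>q\<close> zeros it is
  zero.
\<close>

lemma power_card_add:
  fixes y z :: "'a :: {field, finite} alg_closure"
  shows "(y + z) ^ CARD('a) = y ^ CARD('a) + z ^ CARD('a)"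
proof -
  let ?q = "CARD('a)"
  have shift: "(to_ac b + z) ^ ?q = to_ac b + z ^ ?q" for b :: 'a
  proof -
    have "(to_ac b + z) ^ ?q - (to_ac b + z) = (\<Prod>a\<in>UNIV. z - to_ac (a - b))"
      by (subst power_card_diff_self_eq_prod) (simp add: algebra_simps)
    also have "\<dots> = (\<Prod>a\<in>UNIV. z - to_ac a)"
      by (rule prod.reindex_bij_witness[of _ "\<lambda>a. a + b" "\<lambda>a. a - b"]) auto
    also have "\<dots> = z ^ ?q - z"
      by (rule power_card_diff_self_eq_prod [symmetric])
    finally show ?thesis by (simp add: algebra_simps)
  qed
  \<comment> \<open>The two sides as polynomials in \<open>y\<close>.\<close>
  define p where "p = [:z, 1:] ^ ?q"
  define r where "r = monom 1 ?q + [:z ^ ?q:]"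
  have "degree r \<le> ?q"
    unfolding r_def by (intro degree_add_le degree_monom_le) auto
  moreover have "coeff p ?q = coeff r ?q"
    using card_field_gt_1[where ?'a = 'a]
    by (auto simp: p_def r_def coeff_linear_power coeff_pCons split: nat.splits)
  moreover have "poly p x = poly r x" if "x \<in> range (to_ac :: 'a \<Rightarrow> _)" for x
    using that shift
    by (auto simp: p_def r_def poly_monom power_card_eq_same add.commute simp flip: to_ac_power)
  ultimately have "p = r"
    by (intro poly_eqI_degree_lead_coeff[where n = ?q and A = "range to_ac"])
       (auto simp: card_image inj_to_ac p_def degree_linear_power)
  then have "poly p y = poly r y" by simp
  then show ?thesis by (simp add: p_def r_def poly_monom add.commute)
qed

definition frob :: "nat \<Rightarrow> 'a :: {field, finite} alg_closure \<Rightarrow> 'a alg_closure" where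
  "frob k y = y ^ (CARD('a) ^ k)"

lemma frob_0 [simp]: "frob 0 y = y"
  and frob_mult [simp]: "frob k (y * z) = frob k y * frob k z"
  and frob_zero [simp]: "frob k 0 = 0"
  and frob_one [simp]: "frob k 1 = 1"
  by (simp_all add: frob_def power_mult_distrib power_0_left)

lemma frob_power [simp]: "frob k (y ^ m) = frob k y ^ m"
  by (simp add: frob_def mult.commute flip: power_mult)

lemma frob_frob: "frob j (frob k y) = frob (j + k) y"
  by (simp add: frob_def power_add mult.commute flip: power_mult)

lemma frob_Suc: "frob (Suc k) y = frob k y ^ CARD('a)"
  for y :: "'a :: {field, finite} alg_closure"
  by (simp add: frob_def mult.commute flip: power_mult)

lemma frob_add [simp]: "frob k (y + z) = frob k y + frob k z"
  by (induction k) (simp_all add: frob_Suc power_card_add)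

lemma frob_diff [simp]: "frob k (y - z) = frob k y - frob k z"
  using frob_add[of k "y - z" z] by (simp del: frob_add)

lemma frob_uminus [simp]: "frob k (- y) = - frob k y"
  using frob_diff[of k 0 y] by simp

lemma frob_to_ac [simp]: "frob k (to_ac a) = to_ac a"
  by (induction k) (simp_all add: frob_Suc power_card_eq_same flip: to_ac_power)

lemma frob_numeral [simp]: "frob k (numeral n) = numeral n"
  using frob_to_ac[of k "numeral n"] by simp

lemma frob_eq_iff [simp]: "frob k y = frob k z \<longleftrightarrow> y = z"
proof -
  have "frob k (y - z) = 0 \<longleftrightarrow> y - z = 0"
    by (simp add: frob_def del: frob_diff)
  then show ?thesis by simp
qed

lemma frob_shift_fixed: "frob m y = y \<Longrightarrow> frob (j + m) y = frob j y"
  by (simp flip: frob_frob)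

lemma poly_map_to_ac_frob:
  "poly (map_poly to_ac p) (frob k y) = frob k (poly (map_poly to_ac p) y)"
  by (induction p) (simp_all add: map_poly_pCons)

section \<open>The degree as the least period of the conjugates\<close>

lemma map_poly_mult_hom:
  fixes f :: "'b :: comm_ring_1 \<Rightarrow> 'c :: comm_ring_1"
  assumes zero: "f 0 = 0" and add: "\<And>a b. f (a + b) = f a + f b"
    and mult: "\<And>a b. f (a * b) = f a * f b"
  shows "map_poly f (p * r) = map_poly f p * map_poly f r"
proof (rule poly_eqI)
  have sum: "f (sum g A) = (\<Sum>i\<in>A. f (g i))" for g :: "nat \<Rightarrow> 'b" and A
    by (induction A rule: infinite_finite_induct) (simp_all add: zero add)
  show "coeff (map_poly f (p * r)) n = coeff (map_poly f p * map_poly f r) n" for n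
    by (simp add: coeff_map_poly coeff_mult sum zero mult)
qed

lemma map_poly_frob_prod:
  "map_poly (frob k) (\<Prod>i\<in>A. f i) = (\<Prod>i\<in>A. map_poly (frob k) (f i))"
  by (induction A rule: infinite_finite_induct) (simp_all add: map_poly_mult_hom)

text \<open>
  The witness is the product of \<open>[:- frob k x, 1:]\<close> over \<open>k < m\<close>. Frobenius permutes its
  factors cyclically, so it fixes the coefficients, which therefore lie in the ground field.
\<close>

lemma conjugate_product:
  fixes x :: "'a :: {field, finite} alg_closure"
  assumes "m > 0" "frob m x = x"
  obtains r where "r \<noteq> 0" "degree r = m" "poly (map_poly to_ac r) x = 0"
proof -
  define P where "P = (\<Prod>k<m. [:- frob k x, 1:])"
  define r where "r = map_poly of_ac P"
  obtain n where m: "m = Suc n" using assms(1) by (cases m) auto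
  have "map_poly (frob 1) P = (\<Prod>k<m. [:- frob (Suc k) x, 1:])"
    by (simp add: P_def map_poly_frob_prod map_poly_pCons frob_frob)
  also have "\<dots> = [:- frob m x, 1:] * (\<Prod>k<n. [:- frob (Suc k) x, 1:])"
    unfolding m prod.lessThan_Suc by (rule mult.commute)
  also have "\<dots> = P"
    unfolding assms(2) unfolding P_def m prod.lessThan_Suc_shift by simp
  finally have "frob 1 (coeff P i) = coeff P i" for i
    by (metis coeff_map_poly frob_zero)
  then have "coeff P i \<in> range to_ac" for i
    using power_card_eq_self_iff[of "coeff P i"] by (simp add: frob_def)
  then have rP: "map_poly to_ac r = P"
    by (intro poly_eqI) (simp add: r_def coeff_map_poly to_ac_of_ac)
  have degP: "degree P = m"
    unfolding P_def by (subst degree_prod_eq_sum_degree) auto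
  have deg_r: "degree r = m"
    using degP rP by (metis degree_map_poly to_ac_eq_0_iff)
  then have "r \<noteq> 0" using assms(1) by auto
  moreover have "poly P x = 0"
    using assms(1) by (auto simp: P_def poly_prod intro!: bexI[of _ 0])
  ultimately show thesis using that deg_r rP by simp
qed

lemma alg_degree_le:
  assumes "m > 0" "frob m x = x"
  shows "alg_degree x \<le> m"
proof -
  obtain r where r: "r \<noteq> 0" "degree r = m" "poly (map_poly to_ac r) x = 0"
    using conjugate_product[OF assms] .
  then have "is_min_poly x (min_poly x)" by (intro is_min_poly_min_poly)
  with r show ?thesis by (auto simp: is_min_poly_def alg_degree_def)
qed

text \<open>
  The minimal polynomial vanishes at all conjugates \<open>frob k x\<close>, and by the choice of \<open>m\<close> those
  with \<open>k < m\<close> are distinct: Frobenius is injective, so \<open>frob i x = frob j x\<close> would give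
  \<open>frob (j - i) x = x\<close>.
\<close>

lemma alg_degree_ge:
  assumes "m > 0" "frob m x = x" and least: "\<And>k. 0 < k \<Longrightarrow> k < m \<Longrightarrow> frob k x \<noteq> x"
  shows "m \<le> alg_degree x"
proof -
  obtain r where r: "r \<noteq> 0" "degree r = m" "poly (map_poly to_ac r) x = 0"
    using conjugate_product[OF assms(1,2)] .
  then have "is_min_poly x (min_poly x)" by (intro is_min_poly_min_poly)
  then have mp: "min_poly x \<noteq> 0" "poly (map_poly to_ac (min_poly x)) x = 0"
    by (auto simp: is_min_poly_def)
  let ?p = "map_poly to_ac (min_poly x)"
  have p0: "?p \<noteq> 0"
    using mp by (subst map_poly_eq_0_iff) auto
  have "inj_on (\<lambda>k. frob k x) {..<m}"
  proof (rule linorder_inj_onI)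
    fix i j assume "i < j" "i \<in> {..<m}" "j \<in> {..<m}"
    then have "frob (j - i) x \<noteq> x" by (intro least) auto
    then have "frob i (frob (j - i) x) \<noteq> frob i x" by simp
    with \<open>i < j\<close> show "frob i x \<noteq> frob j x" by (simp add: frob_frob)
  qed auto
  then have "m = card ((\<lambda>k. frob k x) ` {..<m})"
    by (simp add: card_image)
  also have "\<dots> \<le> card {y. poly ?p y = 0}"
    using mp p0 by (intro card_mono poly_roots_finite) (auto simp: poly_map_to_ac_frob)
  also have "\<dots> \<le> degree ?p"
    by (rule card_poly_roots_bound[OF p0])
  also have "\<dots> = alg_degree x"
    by (simp add: alg_degree_def degree_map_poly)
  finally show ?thesis .
qed

lemma alg_degree_eq_Least:
  assumes "m > 0" "frob m x = x"
  shows "alg_degree x = (LEAST k. k > 0 \<and> frob k x = x)"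
proof -
  let ?P = "\<lambda>k. k > 0 \<and> frob k x = x"
  have "?P (Least ?P)" by (rule LeastI[of ?P m]) (use assms in auto)
  moreover have "\<not> ?P k" if "k < Least ?P" for k using that by (rule not_less_Least)
  ultimately show ?thesis
    by (intro antisym alg_degree_le alg_degree_ge) auto
qed

section \<open>Periods of linear recurrences of order two\<close>

lemma geometric_step:
  fixes u :: "nat \<Rightarrow> 'b :: field"
  assumes "w * v = 1" "\<And>k. u (k + 2) = (w + v) * u (k + 1) - u k"
  shows "u (k + 1) - v * u k = w ^ k * (u 1 - v * u 0)"
proof (induction k)
  case (Suc k)
  have "u (Suc k + 1) - v * u (Suc k) = w * (u (k + 1) - v * u k)"
    using assms(2)[of k] assms(1) by (simp add: algebra_simps flip: mult.assoc)
  with Suc show ?case by simp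
qed simp

text \<open>
  The combinations \<open>u (k + 1) - v * u k\<close> and \<open>u (k + 1) - w * u k\<close> are geometric with ratios \<open>w\<close>
  and \<open>v\<close>, where \<open>v\<close> is the inverse of \<open>w\<close>. They determine \<open>u\<close>, since \<open>w \<noteq> v\<close>, and they do not
  both vanish, since \<open>u\<close> is nonzero. Thus a period of \<open>u\<close> is a period of a nonzero geometric
  sequence whose ratio is \<open>w\<close> or its inverse, and conversely.
\<close>

lemma periodic_iff_power_eq_1:
  fixes u :: "nat \<Rightarrow> 'b :: field"
  assumes wv: "w * v = 1" "w \<noteq> v"
    and rec: "\<And>k. u (k + 2) = (w + v) * u (k + 1) - u k"
    and nz: "u 0 \<noteq> 0 \<or> u 1 \<noteq> 0"
  shows "(\<forall>k. u (k + m) = u k) \<longleftrightarrow> w ^ m = 1"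
proof -
  have W: "u (k + 1) - v * u k = w ^ k * (u 1 - v * u 0)" for k
    by (rule geometric_step[OF wv(1) rec])
  have V: "u (k + 1) - w * u k = v ^ k * (u 1 - w * u 0)" for k
    by (rule geometric_step[of v w]) (use wv rec in \<open>simp_all add: mult.commute add.commute\<close>)
  have vm: "v ^ m = 1 \<longleftrightarrow> w ^ m = 1"
    using wv(1) by (metis mult.right_neutral mult_1 power_mult_distrib power_one)
  have not_both: "u 1 - v * u 0 \<noteq> 0 \<or> u 1 - w * u 0 \<noteq> 0"
  proof (rule ccontr)
    assume "\<not> ?thesis"
    then have eq: "u 1 = v * u 0" "u 1 = w * u 0" by auto
    with wv(2) have "u 0 = 0" by (metis mult_cancel_right)
    with eq nz show False by simp
  qed
  show ?thesis
  proof
    assume per: "\<forall>k. u (k + m) = u k"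
    have "u (m + 1) = u 1" "u m = u 0"
      using per[rule_format, of 1] per[rule_format, of 0] by (simp_all add: add.commute)
    then have "(w ^ m - 1) * (u 1 - v * u 0) = 0" "(v ^ m - 1) * (u 1 - w * u 0) = 0"
      using W[of m] V[of m] by (simp_all add: algebra_simps)
    with not_both show "w ^ m = 1" using vm by auto
  next
    assume "w ^ m = 1"
    then have one: "w ^ m = 1" "v ^ m = 1" using vm by auto
    show "\<forall>k. u (k + m) = u k"
    proof
      fix k
      have "(w - v) * u j = w ^ j * (u 1 - v * u 0) - v ^ j * (u 1 - w * u 0)" for j
        unfolding W [symmetric] V [symmetric] by (simp add: algebra_simps)
      from this[of k] this[of "k + m"] have "(w - v) * u (k + m) = (w - v) * u k"
        by (simp add: power_add one)
      with wv(2) show "u (k + m) = u k" by simp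
    qed
  qed
qed

section \<open>The recurrence for the conjugates of a root\<close>

lemma poly_map_to_ac_power:
  "poly (map_poly to_ac (p ^ n)) x = poly (map_poly to_ac p) x ^ n"
  by (induction n) (simp_all add: map_poly_mult_hom map_poly_1)

lemma poly_map_to_ac_g_poly:
  fixes s :: "'a :: {field, finite}"
  defines "n \<equiv> (CARD('a) + 1) div 2"
  shows "poly (map_poly to_ac (g_poly s)) x = x ^ n + (1 - x) ^ n - to_ac s"
proof -
  have add: "map_poly to_ac (p + r) = map_poly to_ac p + map_poly to_ac r"
    and diff: "map_poly to_ac (p - r) = map_poly to_ac p - map_poly to_ac r" for p r :: "'a poly"
    by (intro poly_eqI; simp add: coeff_map_poly)+
  show ?thesis
    by (simp add: g_poly_def Let_def n_def add diff poly_map_to_ac_power map_poly_pCons map_poly_1)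
qed

text \<open>
  The relation is \<open>(x + y - c)\<^sup>2 = 4 * (1 - c) * x * y\<close>, expanded as a quadratic polynomial in the
  conjugate \<open>y\<close> of \<open>x\<close>. It arises by eliminating the square roots \<open>x ^ n\<close> and \<open>(1 - x) ^ n\<close> of
  \<open>x * y\<close> and \<open>(1 - x) * (1 - y)\<close>, whose sum is \<open>s\<close>.
\<close>

lemma root_g_poly_relation:
  fixes s :: "'a :: {field, finite}" and x :: "'a alg_closure"
  assumes "odd (CARD('a))" and root: "poly (map_poly to_ac (g_poly s)) x = 0"
  defines "y \<equiv> frob 1 x" and "c \<equiv> to_ac (1 - s ^ 2)"
  shows "y ^ 2 - ((2 - 4 * c) * x + 2 * c) * y + (x - c) ^ 2 = 0"
proof -
  define n where "n = (CARD('a) + 1) div 2"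
  have n: "n * 2 = Suc (CARD('a))" using assms(1) by (auto simp: n_def elim: oddE)
  define u v where "u = x ^ n" and "v = (1 - x) ^ n"
  have u: "u ^ 2 = x * y"
    by (simp add: u_def y_def frob_def n flip: power_mult)
  have v: "v ^ 2 = (1 - x) * (1 - y)"
  proof -
    have "v ^ 2 = (1 - x) * frob 1 (1 - x)"
      by (simp add: v_def frob_def n del: frob_diff flip: power_mult)
    then show ?thesis by (simp add: y_def)
  qed
  have "u + v = to_ac s"
    using root by (simp add: poly_map_to_ac_g_poly u_def v_def n_def)
  then have "v = to_ac s - u" by (simp add: algebra_simps)
  with v have "(to_ac s - u) ^ 2 = (1 - x) * (1 - y)" by simp
  with u have "2 * to_ac s * u = to_ac s ^ 2 - 1 + x + y"
    by (simp add: power2_eq_square algebra_simps)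
  then have "(2 * to_ac s * u) ^ 2 = (to_ac s ^ 2 - 1 + x + y) ^ 2" by simp
  then have "4 * to_ac s ^ 2 * (x * y) = (to_ac s ^ 2 - 1 + x + y) ^ 2"
    by (simp add: power_mult_distrib u)
  moreover have "to_ac s ^ 2 = 1 - c" by (simp add: c_def)
  ultimately have "4 * (1 - c) * (x * y) = (x + y - c) ^ 2" by (simp add: algebra_simps)
  moreover have "y ^ 2 - ((2 - 4 * c) * x + 2 * c) * y + (x - c) ^ 2
      = (x + y - c) ^ 2 - 4 * (1 - c) * (x * y)"
    by (simp add: power2_eq_square algebra_simps)
  ultimately show ?thesis by simp
qed

text \<open>
  By the symmetry of the relation, \<open>x\<close> and \<open>frob 2 x\<close> are two roots of the same monic quadratic
  polynomial, whose coefficients come from \<open>frob 1 x\<close>. As they differ, their sum is the negative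
  of its linear coefficient.
\<close>

lemma frob_recurrence:
  fixes x :: "'a :: {field, finite} alg_closure" and c' :: 'a
  defines "c \<equiv> to_ac c'"
  assumes rel: "frob 1 x ^ 2 - ((2 - 4 * c) * x + 2 * c) * frob 1 x + (x - c) ^ 2 = 0"
    and neq: "frob 2 x \<noteq> x"
  shows "frob (k + 2) x = (2 - 4 * c) * frob (k + 1) x - frob k x + 2 * c"
proof -
  let ?X = "frob 1 x" and ?Y = "frob 2 x"
  have "frob 1 (?X ^ 2 - ((2 - 4 * c) * x + 2 * c) * ?X + (x - c) ^ 2) = 0"
    by (simp only: rel frob_zero)
  then have rel': "?Y ^ 2 - ((2 - 4 * c) * ?X + 2 * c) * ?Y + (?X - c) ^ 2 = 0"
    by (simp add: c_def frob_frob numeral_2_eq_2)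
  \<comment> \<open>Two roots of one quadratic: subtracting the equations splits off the factor \<open>?Y - x\<close>.\<close>
  have "(?Y - x) * (?Y + x - (2 - 4 * c) * ?X - 2 * c)
      = (?Y ^ 2 - ((2 - 4 * c) * ?X + 2 * c) * ?Y + (?X - c) ^ 2)
        - (?X ^ 2 - ((2 - 4 * c) * x + 2 * c) * ?X + (x - c) ^ 2)"
    by (simp add: power2_eq_square algebra_simps)
  then have "(?Y - x) * (?Y + x - (2 - 4 * c) * ?X - 2 * c) = 0"
    by (simp only: rel rel' diff_self)
  with neq have "?Y + x - (2 - 4 * c) * ?X - 2 * c = 0" by simp
  then have "?Y = (2 - 4 * c) * ?X - x + 2 * c" by (simp add: algebra_simps)
  then have "frob k ?Y = frob k ((2 - 4 * c) * ?X - x + 2 * c)" by simp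
  then show ?thesis by (simp add: c_def frob_frob)
qed

section \<open>Comparison of the two periods\<close>

text \<open>
  A period seen on the natural indices persists on all integers: the shifted sequence satisfies
  the conditions that characterise \<open>S_seq c\<close>.
\<close>

lemma S_seq_periodic_iff:
  "is_period (S_seq c) m \<longleftrightarrow> m > 0 \<and> (\<forall>k. S_seq c (int (k + m)) = S_seq c (int k))"
proof (intro iffI conjI allI)
  assume m: "m > 0 \<and> (\<forall>k. S_seq c (int (k + m)) = S_seq c (int k))"
  have "(\<lambda>k. S_seq c (k + int m)) = S_seq c"
  proof (rule S_seq_unique)
    show "S_seq c (0 + int m) = 0" "S_seq c (1 + int m) = c"
      using m[THEN conjunct2, rule_format, of 0] m[THEN conjunct2, rule_format, of 1] by simp_all
    show "S_seq c (k + 1 + int m)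
        = (2 - 4 * c) * S_seq c (k + int m) - S_seq c (k - 1 + int m) + 2 * c" for k
      using S_seq_rec[of c "k + int m"] by (simp add: algebra_simps)
  qed
  with m show "is_period (S_seq c) m" by (auto simp: is_period_def fun_eq_iff)
qed (auto simp: is_period_def)

theorem theorem4p4:
  fixes s c :: "'a :: {field, finite}" and x :: "'a alg_closure" and d e :: nat
  assumes q_odd: "odd (CARD('a))"
    and c_def: "c = 1 - s ^ 2"
    and c_in: "c \<in> C_set"
    and root: "poly (map_poly to_ac (g_poly s)) x = 0"
    and d_def: "d = alg_degree x"
    and d_gt: "d > 2"
    and e_def: "e = seq_period (S_seq c)"
  shows "d = e"
proof -
  let ?c = "to_ac c"
  have "(2 :: 'a) \<noteq> 0"
  proof
    assume "(2 :: 'a) = 0"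
    then have "CHAR('a) dvd 2" using of_nat_eq_0_iff_char_dvd[of 2, where ?'a = 'a] by simp
    then have "CHAR('a) = 2" by (metis CHAR_not_1 One_nat_def prime_nat_iff two_is_prime_nat)
    with q_odd CHAR_dvd_CARD[where ?'a = 'a] show False by auto
  qed
  then have two: "(2 :: 'a alg_closure) \<noteq> 0"
    by (metis to_ac_eq_0_iff to_ac_numeral)
  then have four: "(4 :: 'a alg_closure) \<noteq> 0"
    by (metis mult_eq_0_iff numeral_Bit0 mult_2)
  have c01: "?c \<noteq> 0" "?c \<noteq> 1"
    using c_in by (auto simp: C_set_def quad_char_def simp flip: to_ac_1)
  \<comment> \<open>The characteristic roots of the homogeneous recurrence, equal only if
      \<open>16 * c * (c - 1)\<close>, the discriminant, vanishes.\<close>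
  obtain w where "poly [:1, -(2 - 4 * ?c), 1:] w = 0"
    using alg_closed_imp_poly_has_root[of "[:1, -(2 - 4 * ?c), 1:]"] by auto
  define v where "v = 2 - 4 * ?c - w"
  have wv: "w * v = 1" and sum: "w + v = 2 - 4 * ?c"
    using \<open>poly _ w = 0\<close> by (simp_all add: v_def algebra_simps eq_neg_iff_add_eq_0)
  have neq: "w \<noteq> v"
  proof
    assume "w = v"
    then have "(2 - 4 * ?c) ^ 2 = 4 * (w * v)"
      using sum by (auto simp flip: sum simp: power2_eq_square)
    then have "(2 - 4 * ?c) ^ 2 - 4 = 0" by (simp add: wv)
    moreover have "(2 - 4 * ?c) ^ 2 - 4 = 4 * (4 * (?c * (?c - 1)))"
      by (simp add: power2_eq_square algebra_simps)
    ultimately have "4 * (4 * (?c * (?c - 1))) = 0" by simp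
    with c01 four show False by (metis mult_eq_0_iff right_minus_eq)
  qed
  have S_iff: "(\<forall>k. S_seq c (int (k + m)) = S_seq c (int k)) \<longleftrightarrow> w ^ m = 1" for m
  proof -
    define u where "u k = 2 - 4 * to_ac (S_seq c (int k))" for k
    have "u (k + 2) = (w + v) * u (k + 1) - u k" for k
    proof -
      have S: "S_seq c (int (k + 2))
          = (2 - 4 * c) * S_seq c (int (k + 1)) - S_seq c (int k) + 2 * c"
        using S_seq_rec[of c "int k + 1"] by (simp add: add.commute)
      show ?thesis
        unfolding u_def sum S by (simp add: algebra_simps)
    qed
    moreover have "u 0 \<noteq> 0" using two by (simp add: u_def)
    ultimately have "(\<forall>k. u (k + m) = u k) \<longleftrightarrow> w ^ m = 1"
      by (intro periodic_iff_power_eq_1[OF wv neq]) auto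
    then show ?thesis using four by (simp add: u_def)
  qed
  have per_S: "is_period (S_seq c) m \<longleftrightarrow> m > 0 \<and> w ^ m = 1" for m
    by (simp only: S_seq_periodic_iff S_iff)
  \<comment> \<open>A conjugate period of 1 or 2 would bound the degree by 2.\<close>
  have frob1: "frob 1 x \<noteq> x" and frob2: "frob 2 x \<noteq> x"
    using alg_degree_le[of 1 x] alg_degree_le[of 2 x] d_gt d_def by auto
  have rec: "frob (k + 2) x = (2 - 4 * ?c) * frob (k + 1) x - frob k x + 2 * ?c" for k
    unfolding c_def
    by (rule frob_recurrence[OF root_g_poly_relation[OF q_odd root] frob2])
  have x_iff: "frob m x = x \<longleftrightarrow> w ^ m = 1" for m
  proof -
    define u where "u k = 2 - 4 * frob k x" for k
    have "u (k + 2) = (w + v) * u (k + 1) - u k" for k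
      unfolding u_def sum rec by (simp add: algebra_simps)
    moreover have "u 1 \<noteq> u 0"
      using frob1 four by (auto simp: u_def)
    then have "u 0 \<noteq> 0 \<or> u 1 \<noteq> 0" by auto
    ultimately have "(\<forall>k. u (k + m) = u k) \<longleftrightarrow> w ^ m = 1"
      by (intro periodic_iff_power_eq_1[OF wv neq]) auto
    moreover have "(\<forall>k. u (k + m) = u k) \<longleftrightarrow> frob m x = x"
      using four by (auto simp: u_def frob_shift_fixed dest: spec[of _ 0])
    ultimately show ?thesis by simp
  qed
  obtain m where "m > 0" "w ^ m = 1"
    using S_seq_has_period[of c] by (auto simp: per_S)
  then have "d = (LEAST k. k > 0 \<and> w ^ k = 1)"
    unfolding d_def by (subst alg_degree_eq_Least[of m]) (simp_all add: x_iff)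
  then show ?thesis
    by (simp add: e_def seq_period_def per_S)
qed

end
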